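(* Let $n$ be a positive integer. For a Dyck path $P$ of length $2n$, let $a(P)$ denote the number of up-steps that $P$ takes before its first down-step, and let $b(P)$ denote the number of positive integers $x\le 2n$ for which $\mathrm{ht}_P(x)=0$. Then the Tutte polynomial of the Catalan matroid $\mathbf{C}_n$ is equal to $$T_{\mathbf{C}_n}(q,t)=\sum_{P\ \mathrm{Dyck}} q^{a(P)}t^{b(P)},$$ where the sum is over all Dyck paths of length $2n$.
   Context: A Dyck path of length $2n$ is a path in the plane from $(0,0)$ to $(2n,0)$, with steps $(1,1)$ (up-steps) and $(1,-1)$ (down-steps), that never passes below the $x$-axis. $\mathrm{ht}_P(x)$ denotes the height of the path $P$ after its first $x$ steps. The up-step set of a path is the set of $i\in[2n]=\{1,\dots,2n\}$ for which the $i$-th step is an up-step. The Catalan matroid $\mathbf{C}_n$ is the matroid on the ground set $[2n]$ whose bases are the up-step sets of all Dyck paths of length $2n$. The Tutte polynomial of a matroid $M$ on a ground set $S$ with rank function $\mathrm{r}$ is $T_M(q,t)=\sum_{A\subseteq S}(q-1)^{\mathrm{r}(S)-\mathrm{r}(A)}(t-1)^{|A|-\mathrm{r}(A)}$. *)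

theory Defs
  imports "HOL-Computational_Algebra.Polynomial"
begin

definition matroid_bases :: "'a set \<Rightarrow> 'a set set \<Rightarrow> bool" where
  "matroid_bases E \<B> \<longleftrightarrow>
     finite E \<and> \<B> \<noteq> {} \<and> (\<forall>B\<in>\<B>. B \<subseteq> E) \<and>
     (\<forall>B\<in>\<B>. \<forall>B'\<in>\<B>. \<forall>x\<in>B - B'. \<exists>y\<in>B' - B. insert y (B - {x}) \<in> \<B>)"

typedef 'a matroid = "{(E :: 'a set, \<B> :: 'a set set). matroid_bases E \<B>}"
  by (rule exI[of _ "({}, {{}})"]) (simp add: matroid_bases_def)

setup_lifting type_definition_matroid

lift_definition ground :: "'a matroid \<Rightarrow> 'a set" is fst .

lift_definition bases :: "'a matroid \<Rightarrow> 'a set set" is snd .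

definition indep :: "'a matroid \<Rightarrow> 'a set \<Rightarrow> bool" where
  "indep M I \<longleftrightarrow> (\<exists>B\<in>bases M. I \<subseteq> B)"

definition rank :: "'a matroid \<Rightarrow> 'a set \<Rightarrow> nat" where
  "rank M A = Max (card ` {I. I \<subseteq> A \<and> indep M I})"

text \<open>
  Polynomials in two variables over the integers are elements of the iterated polynomial
  ring \<open>\<int>[q][t]\<close>. The natural-number subtractions in the exponents below never truncate,
  since \<open>rank M A \<le> rank M (ground M)\<close> and \<open>rank M A \<le> card A\<close> for \<open>A \<subseteq> ground M\<close>.
\<close>

definition q_var :: "int poly poly" where
  "q_var = [:[:0, 1:]:]"

definition t_var :: "int poly poly" where
  "t_var = [:0, 1:]"

definition tutte_polynomial :: "'a matroid \<Rightarrow> int poly poly" where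
  "tutte_polynomial M =
     (\<Sum>A\<in>Pow (ground M).
        (q_var - 1) ^ (rank M (ground M) - rank M A) * (t_var - 1) ^ (card A - rank M A))"

datatype step = Up | Down

fun rise :: "step \<Rightarrow> int" where
  "rise Up = 1"
| "rise Down = -1"

definition height :: "step list \<Rightarrow> nat \<Rightarrow> int" where
  "height P x = (\<Sum>s\<leftarrow>take x P. rise s)"

definition dyck_paths :: "nat \<Rightarrow> step list set" where
  "dyck_paths n =
     {P. length P = 2 * n \<and> (\<forall>x\<le>2 * n. 0 \<le> height P x) \<and> height P (2 * n) = 0}"

text \<open>Steps are numbered from 1, whereas list positions start at 0.\<close>

definition up_steps :: "step list \<Rightarrow> nat set" where
  "up_steps P = {i\<in>{1..length P}. P ! (i - 1) = Up}"

definition initial_ups :: "step list \<Rightarrow> nat" where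
  "initial_ups P = length (takeWhile (\<lambda>s. s = Up) P)"

definition returns :: "step list \<Rightarrow> nat" where
  "returns P = card {x\<in>{1..length P}. height P x = 0}"

lemma height_eq_card:
  assumes "k \<le> length P"
  shows "height P k = 2 * int (card (up_steps P \<inter> {1..k})) - int k"
  using assms
proof (induction k)
  case 0
  then show ?case by (simp add: height_def)
next
  case (Suc k)
  have h: "height P (Suc k) = height P k + rise (P ! k)"
    using Suc.prems by (simp add: height_def take_Suc_conv_app_nth)
  show ?case
  proof (cases "P ! k")
    case Up
    have "up_steps P \<inter> {1..Suc k} = insert (Suc k) (up_steps P \<inter> {1..k})"
      using Suc.prems Up by (auto simp: up_steps_def le_Suc_eq)
    then show ?thesis using h Up Suc by simp
  next
    case Down
    have "up_steps P \<inter> {1..Suc k} = up_steps P \<inter> {1..k}"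
      using Suc.prems Down by (auto simp: up_steps_def le_Suc_eq)
    then show ?thesis using h Down Suc by simp
  qed
qed

lemma up_steps_image_iff:
  "B \<in> up_steps ` dyck_paths n \<longleftrightarrow>
     B \<subseteq> {1..2 * n} \<and> card B = n \<and> (\<forall>k\<le>2 * n. k \<le> 2 * card (B \<inter> {1..k}))"
    (is "?L \<longleftrightarrow> ?R")
proof
  assume ?L
  then obtain P where P: "P \<in> dyck_paths n" and B: "B = up_steps P" by blast
  have len: "length P = 2 * n" using P by (simp add: dyck_paths_def)
  have sub: "B \<subseteq> {1..2 * n}" using B len by (auto simp: up_steps_def)
  then have *: "B \<inter> {1..2 * n} = B" by blast
  have "height P (2 * n) = 0" using P by (simp add: dyck_paths_def)
  then have "card B = n" using height_eq_card[of "2 * n" P] len B * by simp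
  moreover have "k \<le> 2 * card (B \<inter> {1..k})" if "k \<le> 2 * n" for k
  proof -
    have "0 \<le> height P k" using P that by (simp add: dyck_paths_def)
    then show ?thesis using height_eq_card[of k P] len B that by simp
  qed
  ultimately show ?R using sub by blast
next
  assume R: ?R
  define P where "P = map (\<lambda>i. if Suc i \<in> B then Up else Down) [0..<2 * n]"
  have len: "length P = 2 * n" by (simp add: P_def)
  have B: "up_steps P = B"
  proof (rule set_eqI)
    fix i
    show "i \<in> up_steps P \<longleftrightarrow> i \<in> B"
      using R by (cases i) (auto simp: up_steps_def P_def split: if_splits)
  qed
  have h: "height P k = 2 * int (card (B \<inter> {1..k})) - int k" if "k \<le> 2 * n" for k
    using height_eq_card[of k P] that len B by simp
  have "B \<inter> {1..2 * n} = B" using R by blast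
  then have "height P (2 * n) = 0" using h[of "2 * n"] R by simp
  moreover have "0 \<le> height P k" if "k \<le> 2 * n" for k
  proof -
    have "k \<le> 2 * card (B \<inter> {1..k})" using R that by blast
    then show ?thesis using h[OF that] by linarith
  qed
  ultimately have "P \<in> dyck_paths n" using len by (simp add: dyck_paths_def)
  then show ?L using B by blast
qed

lemma matroid_bases_catalan: "matroid_bases {1..2 * n} (up_steps ` dyck_paths n)"
proof -
  have "{1..n} \<in> up_steps ` dyck_paths n"
    unfolding up_steps_image_iff
  proof (intro conjI allI impI)
    fix k assume "k \<le> 2 * n"
    moreover have "{1..n} \<inter> {1..k} = {1..min n k}" by auto
    ultimately show "k \<le> 2 * card ({1..n} \<inter> {1..k})" by simp
  qed auto
  moreover have "\<exists>y\<in>B' - B. insert y (B - {x}) \<in> up_steps ` dyck_paths n"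
    if B: "B \<in> up_steps ` dyck_paths n" and B': "B' \<in> up_steps ` dyck_paths n"
      and x: "x \<in> B - B'" for B B' x
  proof -
    note b = B[unfolded up_steps_image_iff] and b' = B'[unfolded up_steps_image_iff]
    have fin: "finite B" "finite B'" using b b' finite_subset by blast+
    have "B' - B \<noteq> {}"
    proof
      assume "B' - B = {}"
      then have "B' \<subseteq> B" by blast
      then have "B' = B" using b b' fin by (metis card_subset_eq)
      then show False using x by blast
    qed
    define y where "y = Min (B' - B)"
    have y: "y \<in> B' - B" using \<open>B' - B \<noteq> {}\<close> fin unfolding y_def by (intro Min_in) auto
    have y_min: "z \<in> B" if "z \<in> B'" "z < y" for z
    proof (rule ccontr)
      assume "z \<notin> B"
      then have "y \<le> z" using that fin by (auto simp: y_def)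
      then show False using that by simp
    qed
    let ?C = "insert y (B - {x})"
    have "card B > 0" using x fin by (auto simp: card_gt_0_iff)
    then have "card ?C = n" using x y b fin by simp
    moreover have "k \<le> 2 * card (?C \<inter> {1..k})" if k: "k \<le> 2 * n" for k
    proof -
      have bk: "k \<le> 2 * card (B \<inter> {1..k})" and bk': "k \<le> 2 * card (B' \<inter> {1..k})"
        using b b' k by blast+
      show ?thesis
      proof (cases "y \<le> k")
        case True
        have "y \<ge> 1" using y b' by auto
        then have "?C \<inter> {1..k} = insert y (B \<inter> {1..k} - {x})" using True by auto
        then have "card (?C \<inter> {1..k}) = Suc (card (B \<inter> {1..k} - {x}))" using y fin by simp
        moreover have "card (B \<inter> {1..k}) \<le> Suc (card (B \<inter> {1..k} - {x}))"
          unfolding card_Diff_singleton_if by (split if_split) arith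
        ultimately show ?thesis using bk by linarith
      next
        case False
        then have "B' \<inter> {1..k} \<subseteq> ?C \<inter> {1..k}" using y_min x by auto
        then have "card (B' \<inter> {1..k}) \<le> card (?C \<inter> {1..k})" by (intro card_mono) auto
        then show ?thesis using bk' by linarith
      qed
    qed
    moreover have "?C \<subseteq> {1..2 * n}" using b b' y by blast
    ultimately have "?C \<in> up_steps ` dyck_paths n" unfolding up_steps_image_iff by blast
    then show ?thesis using y by blast
  qed
  moreover have "\<forall>B\<in>up_steps ` dyck_paths n. B \<subseteq> {1..2 * n}"
    using up_steps_image_iff by blast
  ultimately show ?thesis unfolding matroid_bases_def by blast
qed

lift_definition catalan_matroid :: "nat \<Rightarrow> nat matroid" is
  "\<lambda>n. ({1..2 * n}, up_steps ` dyck_paths n)"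
  using matroid_bases_catalan by simp

lemma ground_catalan: "ground (catalan_matroid n) = {1..2 * n}"
  by transfer simp

lemma bases_catalan: "bases (catalan_matroid n) = up_steps ` dyck_paths n"
  by transfer simp

end

theory Submission imports Defs begin

text \<open>
  Read the indicator word of \<open>A \<subseteq> {1..2n}\<close> from right to left, and keep an element of \<open>A\<close>
  exactly if at most half of the positions read so far are then kept. This greedy choice
  finds a maximal independent subset of \<open>A\<close>. The number of positions read minus twice the
  number of elements kept is a nonnegative walk that has two ways of leaving 0, by an element
  outside \<open>A\<close> (weight 1) or by a rejected element of \<open>A\<close> (weight \<open>t - 1\<close>). So the Tutte
  polynomial counts nonnegative walks, with weight \<open>t\<close> for each departure from 0 and
  \<open>(q - 1)\<^sup>j\<close> for the final height \<open>2j\<close>. Turning the last \<open>j\<close> up-steps of such a walk into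
  down-steps gives a walk that ends at 0, with \<open>j\<close> marked steps in its final run of
  down-steps. Since \<open>\<Sum>j. (a choose j) (q - 1)\<^sup>j = q\<^sup>a\<close>, this is the sum over Dyck paths, read
  backwards. The last identity is proved by recursion on the length of the walk.
\<close>

subsection \<open>The greedy walk of a word\<close>

text \<open>The head of a word is read last, so structural recursion is the right-to-left scan.
  \<open>slack\<close> is the height of the greedy walk, \<open>overflow\<close> counts rejected
  elements, and \<open>departures\<close> counts letters of either kind read at height 0.\<close>

fun slack :: "step list \<Rightarrow> nat" where
  "slack [] = 0"
| "slack (Down # w) = Suc (slack w)"
| "slack (Up # w) = (if slack w = 0 then 1 else slack w - 1)"

fun overflow :: "step list \<Rightarrow> nat" where
  "overflow [] = 0"
| "overflow (Down # w) = overflow w"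
| "overflow (Up # w) = (if slack w = 0 then Suc (overflow w) else overflow w)"

fun departures :: "step list \<Rightarrow> nat" where
  "departures [] = 0"
| "departures (s # w) = (if slack w = 0 then Suc (departures w) else departures w)"

lemma up_steps_Nil [simp]: "up_steps [] = {}"
  by (simp add: up_steps_def)

lemma up_steps_Cons:
  "up_steps (s # w) = (if s = Up then insert 1 (Suc ` up_steps w) else Suc ` up_steps w)"
proof (rule set_eqI)
  fix i
  show "i \<in> up_steps (s # w) \<longleftrightarrow>
      i \<in> (if s = Up then insert 1 (Suc ` up_steps w) else Suc ` up_steps w)"
  proof (cases i)
    case (Suc j)
    then show ?thesis by (cases j) (auto simp: up_steps_def image_iff)
  qed (auto simp: up_steps_def)
qed

lemma finite_up_steps [simp]: "finite (up_steps w)"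
  by (simp add: up_steps_def)

lemma zero_notin_up_steps [simp]: "0 \<notin> up_steps w"
  by (simp add: up_steps_def)

lemma card_up_steps_Cons:
  "card (up_steps (s # w)) = (if s = Up then Suc (card (up_steps w)) else card (up_steps w))"
  by (auto simp: up_steps_Cons card_image card_insert_if image_iff)

lemma card_up_steps_Int_Cons:
  "card (up_steps (s # w) \<inter> up_steps (s' # w')) =
     (if s = Up \<and> s' = Up then Suc (card (up_steps w \<inter> up_steps w'))
      else card (up_steps w \<inter> up_steps w'))"
proof -
  have "up_steps (s # w) \<inter> up_steps (s' # w') =
      (if s = Up \<and> s' = Up then insert 1 (Suc ` (up_steps w \<inter> up_steps w'))
       else Suc ` (up_steps w \<inter> up_steps w'))"
    by (auto simp: up_steps_Cons image_iff)
  then show ?thesis by (auto simp: card_image card_insert_if image_iff)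
qed

text \<open>The scan keeps \<open>card (up_steps w) - overflow w\<close> elements, and
  \<open>slack w\<close> is the length minus twice that number; the additive form avoids truncated
  subtraction.\<close>

lemma slack_overflow_balance:
  "length w + 2 * overflow w = 2 * card (up_steps w) + slack w"
proof (induction w)
  case (Cons s w)
  then show ?case by (cases s) (auto simp: card_up_steps_Cons)
qed simp

lemma overflow_le_card: "overflow w \<le> card (up_steps w)"
proof (induction w)
  case (Cons s w)
  then show ?case by (cases s) (auto simp: card_up_steps_Cons)
qed simp

lemma bij_betw_up_steps: "bij_betw up_steps {w. length w = m} (Pow {1..m})"
proof (rule bij_betw_imageI)
  show "inj_on up_steps {w. length w = m}"
  proof (rule inj_onI)
    fix v w assume len: "v \<in> {w. length w = m}" "w \<in> {w. length w = m}"
      and eq: "up_steps v = up_steps w"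
    show "v = w"
    proof (rule nth_equalityI)
      fix i assume "i < length v"
      moreover have "Suc i \<in> up_steps v \<longleftrightarrow> Suc i \<in> up_steps w" using eq by simp
      ultimately show "v ! i = w ! i"
        using len by (cases "v ! i"; cases "w ! i") (auto simp: up_steps_def)
    qed (use len in simp)
  qed
  show "up_steps ` {w. length w = m} = Pow {1..m}"
  proof (intro equalityI subsetI)
    fix A assume A: "A \<in> Pow {1..m}"
    define w where "w = map (\<lambda>i. if Suc i \<in> A then Up else Down) [0..<m]"
    have "up_steps w = A"
    proof (rule set_eqI)
      fix i
      show "i \<in> up_steps w \<longleftrightarrow> i \<in> A"
        using A by (cases i) (auto simp: up_steps_def w_def split: if_splits)
    qed
    then show "A \<in> up_steps ` {w. length w = m}" by (force simp: w_def)
  qed (auto simp: up_steps_def)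
qed

subsection \<open>Dyck paths and rank\<close>

lemma slack_eq_neg_sum:
  "overflow w = 0 \<Longrightarrow> int (slack w) = - (\<Sum>s\<leftarrow>w. rise s)"
proof (induction w)
  case (Cons s w)
  then show ?case by (cases s) (auto split: if_splits)
qed simp

text \<open>The first rejection occurs when an \<open>Up\<close> meets slack 0, which is exactly
  when a suffix sum first becomes positive.\<close>

lemma overflow_eq_0_iff:
  "overflow w = 0 \<longleftrightarrow> (\<forall>x. (\<Sum>s\<leftarrow>drop x w. rise s) \<le> 0)"
proof (induction w)
  case (Cons s w)
  have split: "(\<forall>x. (\<Sum>s\<leftarrow>drop x (s # w). rise s) \<le> 0) \<longleftrightarrow>
      rise s + (\<Sum>s\<leftarrow>w. rise s) \<le> 0 \<and> (\<forall>x. (\<Sum>s\<leftarrow>drop x w. rise s) \<le> 0)"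
    (is "(\<forall>x. ?P x) \<longleftrightarrow> _")
  proof -
    have "(\<forall>x. ?P x) \<longleftrightarrow> ?P 0 \<and> (\<forall>x. ?P (Suc x))" by (metis not0_implies_Suc)
    then show ?thesis by simp
  qed
  show ?case
  proof (cases "overflow w = 0")
    case True
    then show ?thesis
      using Cons slack_eq_neg_sum[OF True] unfolding split by (cases s) auto
  next
    case False
    then have "overflow (s # w) \<noteq> 0" by (cases s) auto
    then show ?thesis using Cons False unfolding split by blast
  qed
qed simp

lemma height_plus_sum_drop:
  "height P x + (\<Sum>s\<leftarrow>drop x P. rise s) = (\<Sum>s\<leftarrow>P. rise s)"
  unfolding height_def
  by (metis append_take_drop_id map_append sum_list_append)

text \<open>When the total rise is 0, prefix heights are the negated suffix sums, so a Dyck path can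
  be recognised by scanning from the right.\<close>

lemma dyck_paths_iff:
  "P \<in> dyck_paths n \<longleftrightarrow> length P = 2 * n \<and> overflow P = 0 \<and> slack P = 0"
proof (cases "length P = 2 * n \<and> (\<Sum>s\<leftarrow>P. rise s) = 0")
  case True
  then have h: "height P x = - (\<Sum>s\<leftarrow>drop x P. rise s)" for x
    using height_plus_sum_drop[of P x] by simp
  have "(\<forall>x\<le>2 * n. 0 \<le> height P x) \<longleftrightarrow> overflow P = 0"
  proof
    assume *: "\<forall>x\<le>2 * n. 0 \<le> height P x"
    have "(\<Sum>s\<leftarrow>drop x P. rise s) \<le> 0" for x
      using * True h[of x] by (cases "x \<le> 2 * n") auto
    then show "overflow P = 0" unfolding overflow_eq_0_iff by blast
  qed (simp add: overflow_eq_0_iff h)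
  moreover have "height P (2 * n) = 0" using True h by simp
  moreover have "overflow P = 0 \<Longrightarrow> slack P = 0" using slack_eq_neg_sum[of P] True by simp
  ultimately show ?thesis using True unfolding dyck_paths_def by blast
next
  case False
  moreover have "height P (2 * n) = (\<Sum>s\<leftarrow>P. rise s)" if "length P = 2 * n"
    using that by (simp add: height_def)
  moreover have "(\<Sum>s\<leftarrow>P. rise s) = 0" if "overflow P = 0" "slack P = 0"
    using slack_eq_neg_sum[of P] that by simp
  ultimately show ?thesis unfolding dyck_paths_def by auto
qed

text \<open>Optimality of the greedy choice. At a rejection the scan has kept exactly half of the
  even number \<open>length w\<close>. Up-steps of \<open>s' # u\<close> fill at most half of
  \<open>length w + 1\<close> positions, so by parity they are no more numerous.\<close>

lemma card_up_steps_Int_le: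
  assumes "length w = length u" "overflow u = 0"
  shows "card (up_steps w \<inter> up_steps u) + overflow w \<le> card (up_steps w)"
  using assms
proof (induction w u rule: list_induct2)
  case (Cons s w s' u)
  have u: "overflow u = 0" using Cons.prems by (cases s') (auto split: if_splits)
  show ?case
  proof (cases "s = Up \<and> slack w = 0")
    case True
    have "card (up_steps (s # w) \<inter> up_steps (s' # u)) \<le> card (up_steps (s' # u))"
      by (intro card_mono) auto
    moreover have "2 * card (up_steps (s' # u)) \<le> Suc (length w)"
      using slack_overflow_balance[of "s' # u"] Cons by simp
    ultimately show ?thesis
      using True slack_overflow_balance[of w] by (simp add: card_up_steps_Cons)
  next
    case False
    then show ?thesis
      using Cons.IH[OF u]
      by (cases s) (auto simp: card_up_steps_Int_Cons card_up_steps_Cons)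
  qed
qed simp

text \<open>\<open>u\<close> consists of the kept elements together with the \<open>j\<close>
  leftmost positions outside the set. Each added position lowers the final slack by 2, and adding
  them as late in the scan as possible keeps the walk nonnegative.\<close>

lemma ex_greedy_word:
  assumes "2 * j \<le> slack w"
  shows "\<exists>u. length u = length w \<and> overflow u = 0 \<and> slack u = slack w - 2 * j \<and>
    card (up_steps w \<inter> up_steps u) + overflow w = card (up_steps w)"
  using assms
proof (induction w arbitrary: j)
  case Nil
  then show ?case by simp
next
  case (Cons s w)
  show ?case
  proof (cases s)
    case Up
    show ?thesis
    proof (cases "slack w = 0")
      case True
      with Cons.IH[of 0] obtain u where "length u = length w" "overflow u = 0" "slack u = 0"
        "card (up_steps w \<inter> up_steps u) + overflow w = card (up_steps w)" by auto
      moreover have "j = 0" using Up True Cons.prems by simp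
      ultimately show ?thesis using Up True
        by (intro exI[of _ "Down # u"]) (simp add: card_up_steps_Int_Cons card_up_steps_Cons)
    next
      case False
      then have "2 * j \<le> slack w" using Up Cons.prems by simp
      from Cons.IH[OF this] obtain u where "length u = length w" "overflow u = 0"
        "slack u = slack w - 2 * j"
        "card (up_steps w \<inter> up_steps u) + overflow w = card (up_steps w)" by auto
      \<comment> \<open>Here \<open>2 * j \<le> slack w - 1\<close>, so \<open>slack u\<close> is
        positive and the new \<open>Up\<close> is not rejected.\<close>
      then show ?thesis using Up False Cons.prems
        by (intro exI[of _ "Up # u"]) (simp add: card_up_steps_Int_Cons card_up_steps_Cons)
    qed
  next
    case Down
    show ?thesis
    proof (cases j)
      case 0
      with Cons.IH[of 0] obtain u where "length u = length w" "overflow u = 0"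
        "slack u = slack w"
        "card (up_steps w \<inter> up_steps u) + overflow w = card (up_steps w)" by auto
      then show ?thesis using Down 0
        by (intro exI[of _ "Down # u"]) (simp add: card_up_steps_Int_Cons card_up_steps_Cons)
    next
      case (Suc i)
      with Down Cons.prems Cons.IH[of i] obtain u where "length u = length w"
        "overflow u = 0" "slack u = slack w - 2 * i"
        "card (up_steps w \<inter> up_steps u) + overflow w = card (up_steps w)" by auto
      then show ?thesis using Down Suc Cons.prems
        by (intro exI[of _ "Up # u"])
          (simp add: card_up_steps_Int_Cons card_up_steps_Cons Suc_diff_le)
    qed
  qed
qed

lemma even_slack_iff: "even (slack w) \<longleftrightarrow> even (length w)"
proof -
  have "even (length w + 2 * overflow w) \<longleftrightarrow> even (2 * card (up_steps w) + slack w)"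
    by (simp only: slack_overflow_balance)
  then show ?thesis by simp
qed

lemma rank_catalan:
  assumes "length w = 2 * n"
  shows "rank (catalan_matroid n) (up_steps w) = card (up_steps w) - overflow w"
  unfolding rank_def
proof (rule Max_eqI)
  let ?S = "{I. I \<subseteq> up_steps w \<and> indep (catalan_matroid n) I}"
  show "finite (card ` ?S)" by simp
  show "k \<le> card (up_steps w) - overflow w" if "k \<in> card ` ?S" for k
  proof -
    from that obtain I P where I: "k = card I" "I \<subseteq> up_steps w" "I \<subseteq> up_steps P"
      and P: "P \<in> dyck_paths n"
      by (auto simp: indep_def bases_catalan)
    have "k \<le> card (up_steps w \<inter> up_steps P)" unfolding I(1) using I by (intro card_mono) auto
    then show ?thesis
      using card_up_steps_Int_le[of w P] P assms by (simp add: dyck_paths_iff)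
  qed
  \<comment> \<open>Adding half of the slack brings the walk to 0, which completes the kept set to a
    basis.\<close>
  from assms have "2 * (slack w div 2) = slack w" by (simp add: even_slack_iff)
  with ex_greedy_word[of "slack w div 2" w] obtain P where "length P = length w"
    "overflow P = 0" "slack P = 0"
    and c: "card (up_steps w \<inter> up_steps P) + overflow w = card (up_steps w)" by auto
  then have "P \<in> dyck_paths n" using assms by (simp add: dyck_paths_iff)
  then have "up_steps w \<inter> up_steps P \<in> ?S" by (auto simp: indep_def bases_catalan)
  moreover have "card (up_steps w) - overflow w = card (up_steps w \<inter> up_steps P)"
    using c by simp
  ultimately show "card (up_steps w) - overflow w \<in> card ` ?S" by blast
qed

lemma rank_catalan_ground: "rank (catalan_matroid n) {1..2 * n} = n"
proof -
  let ?w = "replicate (2 * n) Up"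
  have "up_steps ?w = {1..2 * n}" by (auto simp: up_steps_def)
  \<comment> \<open>On a word of \<open>Up\<close> letters the scan alternately rejects and
    keeps.\<close>
  moreover have "slack ?w = 0" by (induction n) auto
  ultimately show ?thesis
    using rank_catalan[of ?w n] slack_overflow_balance[of ?w] by simp
qed

text \<open>Step \<open>x\<close> is read just after the suffix \<open>drop x P\<close>, so it
  departs from 0 exactly if the path has height 0 after \<open>x\<close> steps.\<close>

lemma returns_eq_departures:
  assumes "P \<in> dyck_paths n"
  shows "returns P = departures P"
proof -
  have card: "card {x\<in>{1..length w}. (\<Sum>s\<leftarrow>drop x w. rise s) = 0} = departures w"
    if "overflow w = 0" for w
    using that
  proof (induction w)
    case (Cons s w)
    have w: "overflow w = 0" using Cons.prems by (cases s) (auto split: if_splits)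
    let ?R = "\<lambda>w. {x\<in>{1..length w}. (\<Sum>s\<leftarrow>drop x w. rise s) = 0}"
    have "?R (s # w) = (if slack w = 0 then insert 1 (Suc ` ?R w) else Suc ` ?R w)"
    proof (rule set_eqI)
      fix i
      show "i \<in> ?R (s # w) \<longleftrightarrow>
          i \<in> (if slack w = 0 then insert 1 (Suc ` ?R w) else Suc ` ?R w)"
      proof (cases i)
        case (Suc j)
        then show ?thesis
          using slack_eq_neg_sum[OF w] by (cases j) (auto simp: image_iff)
      qed auto
    qed
    then show ?case
      using Cons.IH[OF w] by (auto simp: card_image card_insert_if image_iff)
  qed simp
  have "height P x = 0 \<longleftrightarrow> (\<Sum>s\<leftarrow>drop x P. rise s) = 0" for x
    using height_plus_sum_drop[of P x] slack_eq_neg_sum[of P] assms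
    by (auto simp: dyck_paths_iff)
  then show ?thesis using card[of P] assms by (simp add: returns_def dyck_paths_iff)
qed

subsection \<open>Generating functions of nonnegative walks\<close>

text \<open>Nonnegative walks of \<open>m\<close> steps from 0 to \<open>k\<close>, with weight
  \<open>t\<close> per departure from 0, split by their last step.\<close>

fun walk_gf :: "'a::comm_ring_1 \<Rightarrow> nat \<Rightarrow> nat \<Rightarrow> 'a" where
  "walk_gf t 0 k = (if k = 0 then 1 else 0)"
| "walk_gf t (Suc m) k =
     (if k = 0 then 0 else (if k = 1 then t else 1) * walk_gf t m (k - 1)) + walk_gf t m (Suc k)"

text \<open>The same walks with an extra \<open>q\<close> for each step of the final falling run. A
  rising last step makes this run empty, so \<open>walk_gf\<close> takes over.\<close>

fun run_gf :: "'a::comm_ring_1 \<Rightarrow> 'a \<Rightarrow> nat \<Rightarrow> nat \<Rightarrow> 'a" where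
  "run_gf q t 0 k = (if k = 0 then 1 else 0)"
| "run_gf q t (Suc m) k =
     (if k = 0 then 0 else (if k = 1 then t else 1) * walk_gf t m (k - 1)) + q * run_gf q t m (Suc k)"

lemma walk_gf_eq_0: "m < k \<Longrightarrow> walk_gf t m k = 0"
  by (induction m arbitrary: k) auto

text \<open>The recursive form of the marking argument: removing the last step from every term gives
  two copies of one sum, with factors 1 and \<open>q - 1\<close>, which add up to \<open>q\<close>.
  The bound on \<open>N\<close> makes all later terms vanish.\<close>

lemma run_gf_eq_sum:
  assumes "m < k + 2 * N"
  shows "run_gf q t m k = (\<Sum>j<N. (q - 1) ^ j * walk_gf t m (k + 2 * j))"
  using assms
proof (induction m arbitrary: k N)
  case 0
  have "(\<Sum>j<N. (q - 1) ^ j * walk_gf t 0 (k + 2 * j)) =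
      (\<Sum>j<N. if j = 0 then if k = 0 then 1 else 0 else 0)"
    by (intro sum.cong) auto
  moreover have "0 < N" if "k = 0" using 0 that by simp
  ultimately show ?case by (simp add: sum.delta)
next
  case (Suc m)
  define f where "f j = walk_gf t m (Suc (k + 2 * j))" for j
  define w where "w = (if k = 0 then 0 else (if k = 1 then t else 1) * walk_gf t m (k - 1))"
  \<comment> \<open>The rise to this height starts at \<open>k + 2 * j + 1 > 0\<close>, so it has
    weight 1.\<close>
  have step: "walk_gf t (Suc m) (k + 2 * Suc j) = f j + f (Suc j)" for j
    by (simp add: f_def)
  have run: "run_gf q t (Suc m) k = w + q * (\<Sum>j<N. (q - 1) ^ j * f j)"
    using Suc.IH[of "Suc k" N] Suc.prems by (simp add: f_def w_def)
  show ?case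
  proof (cases N)
    case 0
    then have "w = 0" using Suc.prems by (auto simp: w_def walk_gf_eq_0)
    then show ?thesis unfolding run using 0 by simp
  next
    case (Suc M)
    \<comment> \<open>The height \<open>k + 2 * M + 1\<close> exceeds \<open>m\<close>, so the sums
      up to \<open>M\<close> and up to \<open>N\<close> agree.\<close>
    have fM: "f M = 0" using Suc.prems Suc by (simp add: f_def walk_gf_eq_0)
    have "(\<Sum>j<N. (q - 1) ^ j * walk_gf t (Suc m) (k + 2 * j)) =
        walk_gf t (Suc m) k + (\<Sum>j<M. (q - 1) ^ Suc j * (f j + f (Suc j)))"
      unfolding Suc sum.lessThan_Suc_shift step by simp
    also have "\<dots> = w + (f 0 + (\<Sum>j<M. (q - 1) ^ Suc j * f (Suc j)))
        + (q - 1) * (\<Sum>j<M. (q - 1) ^ j * f j)"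
    proof -
      have "walk_gf t (Suc m) k = w + f 0" by (simp add: w_def f_def)
      moreover have "(\<Sum>j<M. (q - 1) ^ Suc j * (f j + f (Suc j))) =
          (\<Sum>j<M. (q - 1) ^ Suc j * f j) + (\<Sum>j<M. (q - 1) ^ Suc j * f (Suc j))"
        by (simp only: distrib_left sum.distrib)
      moreover have "(\<Sum>j<M. (q - 1) ^ Suc j * f j) = (q - 1) * (\<Sum>j<M. (q - 1) ^ j * f j)"
        by (simp add: sum_distrib_left mult.assoc)
      ultimately show ?thesis by (simp only: ac_simps)
    qed
    also have "f 0 + (\<Sum>j<M. (q - 1) ^ Suc j * f (Suc j)) = (\<Sum>j<N. (q - 1) ^ j * f j)"
      unfolding Suc sum.lessThan_Suc_shift by simp
    also have "(\<Sum>j<M. (q - 1) ^ j * f j) = (\<Sum>j<N. (q - 1) ^ j * f j)"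
      unfolding Suc using fM by simp
    finally show ?thesis unfolding run by (simp add: algebra_simps)
  qed
qed

section \<open>Sums over words as generating functions of walks\<close>

lemma finite_words [simp]: "finite {w :: step list. length w = m}"
proof -
  have "(UNIV :: step set) = {Up, Down}" using step.exhaust by auto
  then have "finite (UNIV :: step set)" by (metis finite.emptyI finite.insertI)
  then show ?thesis using finite_lists_length_eq[of UNIV m] by simp
qed

lemma sum_words_Suc:
  "(\<Sum>w | length w = Suc m. f w) = (\<Sum>w | length w = m. f (Down # w) + f (Up # w))"
proof -
  let ?W = "{w :: step list. length w = m}"
  have "{w. length w = Suc m} = (#) Down ` ?W \<union> (#) Up ` ?W"
  proof (rule set_eqI)
    fix w
    show "w \<in> {w. length w = Suc m} \<longleftrightarrow> w \<in> (#) Down ` ?W \<union> (#) Up ` ?W"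
    proof (cases w)
      case (Cons s v)
      then show ?thesis by (cases s) auto
    qed auto
  qed
  then have "(\<Sum>w | length w = Suc m. f w) = sum f ((#) Down ` ?W) + sum f ((#) Up ` ?W)"
    by (simp only:) (rule sum.union_disjoint; auto)
  also have "\<dots> = (\<Sum>w\<in>?W. f (Down # w) + f (Up # w))"
    by (simp add: sum.reindex sum.distrib)
  finally show ?thesis .
qed

text \<open>At slack 0 both letters lead to 1, with weights 1 and \<open>t - 1\<close>, total
  \<open>t\<close>. At positive slack the two letters are the two directions of the walk.\<close>

lemma sum_overflow_eq_walk_gf:
  fixes t :: "'a::comm_ring_1"
  shows "(\<Sum>w | length w = m. if slack w = k then (t - 1) ^ overflow w else 0) = walk_gf t m k"
proof (induction m arbitrary: k)
  case (Suc m)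
  show ?case
    unfolding sum_words_Suc walk_gf.simps Suc[symmetric] sum_distrib_left
    by (cases "k = 0") (auto simp: sum.distrib[symmetric] sum_distrib_left algebra_simps
        intro!: sum.cong)
qed simp

text \<open>Without rejections only \<open>Down\<close> can leave 0, and \<open>departures\<close>
  gives it the weight \<open>t\<close>.\<close>

lemma sum_departures_eq_walk_gf:
  fixes t :: "'a::comm_ring_1"
  shows "(\<Sum>w | length w = m. if overflow w = 0 \<and> slack w = k then t ^ departures w else 0)
    = walk_gf t m k"
proof (induction m arbitrary: k)
  case (Suc m)
  show ?case
    unfolding sum_words_Suc walk_gf.simps Suc[symmetric] sum_distrib_left
    by (cases "k = 0") (auto simp: sum.distrib[symmetric] sum_distrib_left algebra_simps
        intro!: sum.cong)
qed simp

lemma initial_ups_simps [simp]: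
  "initial_ups [] = 0"
  "initial_ups (Up # w) = Suc (initial_ups w)"
  "initial_ups (Down # w) = 0"
  by (simp_all add: initial_ups_def)

text \<open>Without rejections every \<open>Up\<close> lowers the walk, so the initial up-steps of a
  word are the final falling run of its walk.\<close>

lemma sum_initial_ups_eq_run_gf:
  fixes q t :: "'a::comm_ring_1"
  shows "(\<Sum>w | length w = m. if overflow w = 0 \<and> slack w = k
      then q ^ initial_ups w * t ^ departures w else 0) = run_gf q t m k"
proof (induction m arbitrary: k)
  case (Suc m)
  show ?case
    unfolding sum_words_Suc run_gf.simps Suc[symmetric] sum_departures_eq_walk_gf[symmetric]
      sum_distrib_left
    by (cases "k = 0") (auto simp: sum.distrib[symmetric] sum_distrib_left algebra_simps
        intro!: sum.cong)
qed simp

theorem theorem3p4: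
  fixes n :: nat
  assumes "n \<ge> 1"
  shows "tutte_polynomial (catalan_matroid n)
           = (\<Sum>P\<in>dyck_paths n. q_var ^ initial_ups P * t_var ^ returns P)"
proof -
  let ?M = "catalan_matroid n" and ?W = "{w :: step list. length w = 2 * n}"
  have "tutte_polynomial ?M = (\<Sum>w\<in>?W. (q_var - 1) ^ (n - rank ?M (up_steps w)) *
      (t_var - 1) ^ (card (up_steps w) - rank ?M (up_steps w)))"
    unfolding tutte_polynomial_def ground_catalan rank_catalan_ground
    by (rule sum.reindex_bij_betw[OF bij_betw_up_steps, symmetric])
  also have "\<dots> = (\<Sum>w\<in>?W. (q_var - 1) ^ (slack w div 2) * (t_var - 1) ^ overflow w)"
  proof (rule sum.cong[OF refl])
    fix w assume w: "w \<in> ?W"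
    \<comment> \<open>The rank is the number of kept elements, so the corank is half the slack and
      the nullity is the number of rejections.\<close>
    have "n - (card (up_steps w) - overflow w) = slack w div 2"
      using w slack_overflow_balance[of w] overflow_le_card[of w] by simp
    then show "(q_var - 1) ^ (n - rank ?M (up_steps w)) *
        (t_var - 1) ^ (card (up_steps w) - rank ?M (up_steps w)) =
        (q_var - 1) ^ (slack w div 2) * (t_var - 1) ^ overflow w"
      using w overflow_le_card[of w] by (simp add: rank_catalan)
  qed
  \<comment> \<open>The final height is even and at most \<open>2 * n\<close>; sorting words by it
    leaves an inner sum over words for each \<open>j\<close>.\<close>
  also have "\<dots> = (\<Sum>w\<in>?W. \<Sum>j<Suc n. if slack w = 2 * j
      then (q_var - 1) ^ j * (t_var - 1) ^ overflow w else 0)"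
  proof (rule sum.cong[OF refl])
    fix w assume w: "w \<in> ?W"
    have "slack w div 2 < Suc n"
      using w slack_overflow_balance[of w] overflow_le_card[of w] by simp
    moreover have "slack w = 2 * j \<longleftrightarrow> slack w div 2 = j" for j
      using w even_slack_iff[of w] by auto
    ultimately show "(q_var - 1) ^ (slack w div 2) * (t_var - 1) ^ overflow w =
        (\<Sum>j<Suc n. if slack w = 2 * j then (q_var - 1) ^ j * (t_var - 1) ^ overflow w else 0)"
      by (simp add: sum.delta' del: sum.lessThan_Suc)
  qed
  also have "\<dots> = (\<Sum>j<Suc n. (q_var - 1) ^ j * walk_gf t_var (2 * n) (0 + 2 * j))"
    unfolding sum_overflow_eq_walk_gf[symmetric] sum_distrib_left
    by (subst sum.swap) (intro sum.cong, auto)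
  also have "\<dots> = run_gf q_var t_var (2 * n) 0"
    by (rule run_gf_eq_sum[symmetric]) simp
  also have "\<dots> = (\<Sum>P\<in>dyck_paths n. q_var ^ initial_ups P * t_var ^ departures P)"
    unfolding sum_initial_ups_eq_run_gf[symmetric]
    by (subst sum.inter_filter[symmetric]) (auto simp: dyck_paths_iff intro!: sum.cong)
  also have "\<dots> = (\<Sum>P\<in>dyck_paths n. q_var ^ initial_ups P * t_var ^ returns P)"
    by (simp add: returns_eq_departures)
  finally show ?thesis .
qed

end
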